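(* Let $\Gamma$ be a Neumaier graph with coherent rank at most $4$. Then $\Gamma$ is strongly regular.
   Context: A graph is $(v,k,\lambda)$-edge-regular if it has $v$ vertices, is $k$-regular and each edge lies in exactly $\lambda$ triangles. A Neumaier graph is a non-complete edge-regular graph having a clique $C$ such that every vertex outside $C$ is adjacent to exactly $e>0$ vertices of $C$. A graph is strongly regular if it is edge-regular and any two distinct nonadjacent vertices have a constant number $\mu$ of common neighbours. A coherent algebra is a subalgebra of complex square matrices containing $I$ and $J$ (all-ones), closed under transpose, matrix product and entrywise (Hadamard) product. The coherent closure $\mathcal W(\Gamma)$ is the smallest coherent algebra containing the adjacency matrix $A(\Gamma)$, and the coherent rank of $\Gamma$ is its dimension. *)

theory Defs
  imports "HOL-Analysis.Analysis"
begin

text \<open>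
  A finite graph is represented by its adjacency relation on a finite type of vertices.
\<close>

definition simple_graph :: "('n \<Rightarrow> 'n \<Rightarrow> bool) \<Rightarrow> bool" where
  "simple_graph adj \<longleftrightarrow> (\<forall>x y. adj x y \<longrightarrow> adj y x) \<and> (\<forall>x. \<not> adj x x)"

definition clique :: "('n \<Rightarrow> 'n \<Rightarrow> bool) \<Rightarrow> 'n set \<Rightarrow> bool" where
  "clique adj C \<longleftrightarrow> (\<forall>x\<in>C. \<forall>y\<in>C. x \<noteq> y \<longrightarrow> adj x y)"

definition triangle :: "('n \<Rightarrow> 'n \<Rightarrow> bool) \<Rightarrow> 'n set \<Rightarrow> bool" where
  "triangle adj T \<longleftrightarrow> card T = 3 \<and> clique adj T"

definition edge_regular_with ::
    "('n::finite \<Rightarrow> 'n \<Rightarrow> bool) \<Rightarrow> nat \<Rightarrow> nat \<Rightarrow> nat \<Rightarrow> bool" where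
  "edge_regular_with adj v k l \<longleftrightarrow>
     simple_graph adj \<and>
     CARD('n) = v \<and>
     (\<forall>x. card {y. adj x y} = k) \<and>
     (\<forall>x y. adj x y \<longrightarrow> card {T. triangle adj T \<and> x \<in> T \<and> y \<in> T} = l)"

definition edge_regular :: "('n::finite \<Rightarrow> 'n \<Rightarrow> bool) \<Rightarrow> bool" where
  "edge_regular adj \<longleftrightarrow> (\<exists>v k l. edge_regular_with adj v k l)"

definition complete_graph :: "('n \<Rightarrow> 'n \<Rightarrow> bool) \<Rightarrow> bool" where
  "complete_graph adj \<longleftrightarrow> (\<forall>x y. x \<noteq> y \<longrightarrow> adj x y)"

text \<open>
  The clique in the following definition is automatically nonempty and proper: the graph is
  not complete, and \<open>e > 0\<close>.
\<close>

definition neumaier_graph :: "('n::finite \<Rightarrow> 'n \<Rightarrow> bool) \<Rightarrow> bool" where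
  "neumaier_graph adj \<longleftrightarrow>
     edge_regular adj \<and> \<not> complete_graph adj \<and>
     (\<exists>C e. clique adj C \<and> e > 0 \<and> (\<forall>x. x \<notin> C \<longrightarrow> card {y \<in> C. adj x y} = e))"

definition strongly_regular :: "('n::finite \<Rightarrow> 'n \<Rightarrow> bool) \<Rightarrow> bool" where
  "strongly_regular adj \<longleftrightarrow>
     edge_regular adj \<and>
     (\<exists>\<mu>. \<forall>x y. x \<noteq> y \<and> \<not> adj x y \<longrightarrow> card {z. adj x z \<and> adj y z} = \<mu>)"

text \<open>
  Scalars are complex, so that the dimension below is the dimension over the complex numbers;
  the library's \<open>dim\<close> on this type would be the real dimension.
\<close>

definition cscale :: "complex \<Rightarrow> complex^'n^'n \<Rightarrow> complex^'n^'n" where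
  "cscale c A = (\<chi> i j. c * A $ i $ j)"

definition unit_matrices :: "(complex^'n^'n) set" where
  "unit_matrices = range (\<lambda>(p, q). \<chi> i j. if i = p \<and> j = q then 1 else 0)"

global_interpretation cmat: vector_space "cscale :: complex \<Rightarrow> complex^'n^'n \<Rightarrow> complex^'n^'n"
  by unfold_locales (simp_all add: cscale_def vec_eq_iff algebra_simps)

lemma finite_unit_matrices: "finite (unit_matrices :: (complex^'n::finite^'n) set)"
  by (simp add: unit_matrices_def)

lemma span_unit_matrices: "cmat.span (unit_matrices :: (complex^'n::finite^'n) set) = UNIV"
proof -
  have "A \<in> cmat.span unit_matrices" for A :: "complex^'n^'n"
  proof -
    let ?E = "\<lambda>p q. (\<chi> i j. if i = p \<and> j = q then 1 else 0) :: complex^'n^'n"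
    have "(\<Sum>p\<in>UNIV. \<Sum>q\<in>UNIV. A $ p $ q * (if i = p \<and> j = q then 1 else 0)) = A $ i $ j"
      for i j
    proof -
      have "(\<Sum>p\<in>UNIV. \<Sum>q\<in>UNIV. A $ p $ q * (if i = p \<and> j = q then 1 else 0))
          = (\<Sum>p\<in>UNIV. \<Sum>q\<in>UNIV. if j = q then if i = p then A $ p $ q else 0 else 0)"
        by (intro sum.cong refl) simp
      then show ?thesis by simp
    qed
    then have "A = (\<Sum>p\<in>UNIV. \<Sum>q\<in>UNIV. cscale (A $ p $ q) (?E p q))"
      unfolding vec_eq_iff cscale_def by (simp only: sum_component vec_lambda_beta) simp
    moreover have "?E p q \<in> unit_matrices" for p q
      unfolding unit_matrices_def by (rule image_eqI[where x = "(p, q)"]) auto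
    ultimately show ?thesis
      by (metis (no_types, lifting) cmat.span_sum cmat.span_scale cmat.span_base)
  qed
  then show ?thesis by auto
qed

definition all_ones :: "complex^'n^'n" where
  "all_ones = (\<chi> i j. 1)"

definition hadamard :: "complex^'n^'n \<Rightarrow> complex^'n^'n \<Rightarrow> complex^'n^'n" where
  "hadamard A B = (\<chi> i j. A $ i $ j * B $ i $ j)"

definition coherent_algebra :: "(complex^'n::finite^'n) set \<Rightarrow> bool" where
  "coherent_algebra W \<longleftrightarrow>
     cmat.subspace W \<and>
     mat 1 \<in> W \<and>
     all_ones \<in> W \<and>
     (\<forall>A\<in>W. transpose A \<in> W) \<and>
     (\<forall>A\<in>W. \<forall>B\<in>W. A ** B \<in> W) \<and>
     (\<forall>A\<in>W. \<forall>B\<in>W. hadamard A B \<in> W)"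

definition adjacency_matrix :: "('n \<Rightarrow> 'n \<Rightarrow> bool) \<Rightarrow> complex^'n^'n" where
  "adjacency_matrix adj = (\<chi> i j. if adj i j then 1 else 0)"

definition coherent_closure :: "('n::finite \<Rightarrow> 'n \<Rightarrow> bool) \<Rightarrow> (complex^'n^'n) set" where
  "coherent_closure adj = \<Inter> {W. coherent_algebra W \<and> adjacency_matrix adj \<in> W}"

lemma coherent_algebra_coherent_closure: "coherent_algebra (coherent_closure adj)"
  unfolding coherent_closure_def coherent_algebra_def cmat.subspace_def by auto

lemma adjacency_matrix_in_coherent_closure: "adjacency_matrix adj \<in> coherent_closure adj"
  unfolding coherent_closure_def by auto

lemma coherent_closure_least:
  "coherent_algebra W \<Longrightarrow> adjacency_matrix adj \<in> W \<Longrightarrow> coherent_closure adj \<subseteq> W"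
  unfolding coherent_closure_def by auto

definition coherent_rank :: "('n::finite \<Rightarrow> 'n \<Rightarrow> bool) \<Rightarrow> nat" where
  "coherent_rank adj = cmat.dim (coherent_closure adj)"

lemma coherent_rank_finite_basis:
  obtains B where "finite B" "cmat.independent B" "cmat.span B = coherent_closure adj"
    "card B = coherent_rank adj"
proof -
  have sub: "cmat.subspace (coherent_closure adj)"
    using coherent_algebra_coherent_closure[of adj] by (simp add: coherent_algebra_def)
  obtain B where B: "B \<subseteq> coherent_closure adj" "cmat.independent B"
      "coherent_closure adj \<subseteq> cmat.span B" "card B = coherent_rank adj"
    unfolding coherent_rank_def by (rule cmat.basis_exists)
  have "finite B"
    using cmat.independent_span_bound[OF finite_unit_matrices B(2)] span_unit_matrices by auto
  moreover have "cmat.span B = coherent_closure adj"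
    using B(1,3) sub by (simp add: cmat.span_minimal subset_antisym)
  ultimately show thesis using that B by blast
qed

end

theory Submission
  imports Defs
begin

text \<open>
  Write \<open>c = card C\<close>, \<open>J\<close> for the all-ones matrix, \<open>u\<close> for the indicator vector of the clique \<open>C\<close>
  and \<open>\<theta> = c - 1 - e\<close>, so that \<open>A u = \<theta> u + e 1\<close>. If the graph is not strongly regular, then \<open>I\<close>,
  \<open>A\<close>, \<open>J - I - A\<close> and the part of \<open>A\<^sup>2\<close> supported on the non-edges are linearly independent. As
  the rank is at most 4 they span the coherent closure, all of whose members are therefore
  constant on the diagonal and on the edges.
  The matrix \<open>B = (k I + (c - 1) A) (A - \<theta> I) - e k J\<close> kills \<open>u\<close> and the all-ones vector, hence so
  does \<open>M = (A - \<theta> I) B\<close>. With diagonal value \<open>d\<close> and edge value \<open>a\<close> of \<open>M\<close>, the clique gives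
  \<open>0 = u\<^sup>T M u = c (d + (c - 1) a)\<close>, while \<open>tr B\<^sup>2 = v k (d + (c - 1) a)\<close>. As \<open>B\<close> is real symmetric,
  it vanishes, and so \<open>(c - 1) A\<^sup>2\<close> is constantly \<open>e k\<close> on non-edges, a contradiction.
\<close>

section \<open>Scalar matrices, distributive laws and traces\<close>

lemma mat_eq_cscale: "mat a = cscale a (mat 1)"
  by (simp add: cscale_def mat_def vec_eq_iff)

lemma mat_component: "mat a $ i $ j = (if i = j then a else 0)"
  by (simp add: mat_def)

lemma mat_mult_vector: "(mat a :: complex^'n^'n) *v x = a *s x"
  by (simp add: vec_eq_iff matrix_vector_mult_def mat_def if_distrib[where f = "\<lambda>z. z * _"] cong: if_cong)

text \<open>Scalars enter later matrices as factors \<open>mat a\<close>, so the product rule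
  suffices for membership in a coherent algebra.\<close>

lemma mat_mult_component: "(mat a ** (X :: complex^'n^'n)) $ i $ j = a * X $ i $ j"
  by (simp add: matrix_matrix_mult_def mat_def if_distrib[where f = "\<lambda>z. z * _"] cong: if_cong)

lemma mult_mat_component: "((X :: complex^'n^'n) ** mat a) $ i $ j = X $ i $ j * a"
  by (simp add: matrix_matrix_mult_def mat_def if_distrib[where f = "\<lambda>z. _ * z"] cong: if_cong)

lemma matrix_add_rdistrib: "((X :: 'a::semiring_1^'n^'m) + Y) ** Z = X ** Z + Y ** Z"
  by (simp add: vec_eq_iff matrix_matrix_mult_def distrib_right sum.distrib)

lemma matrix_sub_ldistrib: "(X :: 'a::ring_1^'n^'m) ** (Y - Z) = X ** Y - X ** Z"
  by (simp add: vec_eq_iff matrix_matrix_mult_def right_diff_distrib sum_subtractf)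

lemma matrix_sub_rdistrib: "((X :: 'a::ring_1^'n^'m) - Y) ** Z = X ** Z - Y ** Z"
  by (simp add: vec_eq_iff matrix_matrix_mult_def left_diff_distrib sum_subtractf)

lemma trace_mult: "trace (X ** Y) = (\<Sum>i\<in>UNIV. \<Sum>j\<in>UNIV. X $ i $ j * Y $ j $ i)"
  by (simp add: trace_def matrix_matrix_mult_def)

section \<open>Closure rules of coherent algebras\<close>

context
  fixes W :: "(complex^'n::finite^'n) set"
  assumes W: "coherent_algebra W"
begin

lemma coherent_algebra_mat: "mat a \<in> W"
  unfolding mat_eq_cscale[of a] using W by (auto simp: coherent_algebra_def cmat.subspace_def)

lemma coherent_algebra_add: "X \<in> W \<Longrightarrow> Y \<in> W \<Longrightarrow> X + Y \<in> W"
  using W by (auto simp: coherent_algebra_def cmat.subspace_def)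

lemma coherent_algebra_diff: "X \<in> W \<Longrightarrow> Y \<in> W \<Longrightarrow> X - Y \<in> W"
  using W cmat.subspace_diff by (auto simp: coherent_algebra_def)

lemma coherent_algebra_mult: "X \<in> W \<Longrightarrow> Y \<in> W \<Longrightarrow> X ** Y \<in> W"
  using W by (auto simp: coherent_algebra_def)

lemma coherent_algebra_hadamard: "X \<in> W \<Longrightarrow> Y \<in> W \<Longrightarrow> hadamard X Y \<in> W"
  using W by (auto simp: coherent_algebra_def)

lemma coherent_algebra_all_ones: "all_ones \<in> W"
  using W by (auto simp: coherent_algebra_def)

end

section \<open>Entries of matrices in a closure of rank at most 4\<close>

lemma adjacency_square_component:
  assumes "simple_graph adj"
  shows "(adjacency_matrix adj ** adjacency_matrix adj) $ x $ y = of_nat (card {z. adj x z \<and> adj y z})"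
proof -
  have "adj z y \<longleftrightarrow> adj y z" for z
    using assms by (auto simp: simple_graph_def)
  then have "(adjacency_matrix adj ** adjacency_matrix adj) $ x $ y
      = (\<Sum>z\<in>UNIV. if adj x z \<and> adj y z then 1 else 0)"
    unfolding matrix_matrix_mult_def adjacency_matrix_def
    by (auto intro!: sum.cong)
  then show ?thesis
    by (simp add: sum.If_cases)
qed

text \<open>The pairs \<open>p\<close>, \<open>q\<close> and \<open>r\<close>, \<open>s\<close>
  witness that strong regularity fails. Non-edges are absent from the conclusion because
  \<open>N\<close> below already takes different values on these two.\<close>

lemma coherent_closure_constant_on_edges:
  fixes adj :: "'n::finite \<Rightarrow> 'n \<Rightarrow> bool"
  assumes simple: "simple_graph adj" and rank: "coherent_rank adj \<le> 4"
    and pq: "p \<noteq> q" "\<not> adj p q" and rs: "r \<noteq> s" "\<not> adj r s"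
    and ne: "card {z. adj p z \<and> adj q z} \<noteq> card {z. adj r z \<and> adj s z}"
    and M: "M \<in> coherent_closure adj"
  obtains d a where "\<And>x. M $ x $ x = d" "\<And>x y. adj x y \<Longrightarrow> M $ x $ y = a"
proof -
  define A where "A = adjacency_matrix adj"
  define L where "L = all_ones - mat 1 - A"
  define N where "N = hadamard (A ** A) L"
  let ?W = "coherent_closure adj"
  note W = coherent_algebra_coherent_closure[of adj]
  have irrefl: "\<not> adj x x" for x
    using simple by (simp add: simple_graph_def)
  have A_in: "A \<in> ?W"
    by (simp add: A_def adjacency_matrix_in_coherent_closure)
  have L_in: "L \<in> ?W"
    unfolding L_def using A_in
    by (intro coherent_algebra_diff[OF W] coherent_algebra_all_ones[OF W] coherent_algebra_mat[OF W])
  have N_in: "N \<in> ?W"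
    unfolding N_def using A_in L_in
    by (intro coherent_algebra_hadamard[OF W] coherent_algebra_mult[OF W])
  have A_nth: "A $ x $ y = (if adj x y then 1 else 0)" for x y
    by (simp add: A_def adjacency_matrix_def)
  have L_nth: "L $ x $ y = (if x = y \<or> adj x y then 0 else 1)" for x y
    using irrefl by (auto simp: L_def A_nth all_ones_def mat_def)
  have N_nth: "N $ x $ y =
      (if x = y \<or> adj x y then 0 else of_nat (card {z. adj x z \<and> adj y z}))" for x y
    using adjacency_square_component[OF simple, of x y]
    by (simp add: N_def L_nth hadamard_def A_def)
  \<comment> \<open>Without edges, both numbers of common neighbours would be 0.\<close>
  obtain u w where uw: "adj u w"
    using ne by fastforce
  have "mat 1 \<notin> cmat.span ({} :: (complex^'n^'n) set)"
    by (simp add: vec_eq_iff mat_def)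
  then have indep1: "cmat.independent {mat 1 :: complex^'n^'n}"
    by (simp add: cmat.independent_insert)
  \<comment> \<open>Each new matrix leaves the previous span by violating one linear equation: the
    entry at \<open>u\<close>, \<open>w\<close> vanishes, then the one at \<open>p\<close>,
    \<open>q\<close>, and finally the entries at \<open>p\<close>, \<open>q\<close> and
    \<open>r\<close>, \<open>s\<close> agree.\<close>
  have "cmat.span {mat 1 :: complex^'n^'n} \<subseteq> {X. X $ u $ w = 0}"
    using uw irrefl by (intro cmat.span_minimal) (auto simp: cmat.subspace_def cscale_def mat_def)
  then have A_notin: "A \<notin> cmat.span {mat 1}"
    using uw by (auto simp: A_nth)
  then have indep2: "cmat.independent {A, mat 1}"
    using indep1 cmat.independent_insertI by blast
  have "cmat.span {A, mat 1} \<subseteq> {X. X $ p $ q = 0}"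
    using pq by (intro cmat.span_minimal) (auto simp: cmat.subspace_def cscale_def mat_def A_nth)
  then have L_notin: "L \<notin> cmat.span {A, mat 1}"
    using pq by (auto simp: L_nth)
  then have indep3: "cmat.independent {L, A, mat 1}"
    using indep2 cmat.independent_insertI by blast
  have "cmat.span {L, A, mat 1} \<subseteq> {X. X $ p $ q = X $ r $ s}"
    using pq rs
    by (intro cmat.span_minimal) (auto simp: cmat.subspace_def cscale_def mat_def A_nth L_nth)
  moreover have "N $ p $ q \<noteq> N $ r $ s"
    using pq rs ne by (simp add: N_nth)
  ultimately have N_notin: "N \<notin> cmat.span {L, A, mat 1}"
    by blast
  then have indep4: "cmat.independent {N, L, A, mat 1}"
    using indep3 cmat.independent_insertI by blast
  have "M \<in> cmat.span {N, L, A, mat 1}"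
  proof (rule ccontr)
    assume nspan: "M \<notin> cmat.span {N, L, A, mat 1}"
    then have indep5: "cmat.independent {M, N, L, A, mat 1}"
      using indep4 cmat.independent_insertI by blast
    obtain B where B: "finite B" "cmat.span B = ?W" "card B = coherent_rank adj"
      using coherent_rank_finite_basis[of adj] by metis
    have "{M, N, L, A, mat 1} \<subseteq> cmat.span B"
      unfolding B(2) using M N_in L_in A_in coherent_algebra_mat[OF W] by simp
    then have "card {M, N, L, A, mat 1} \<le> 4"
      using cmat.independent_span_bound[OF B(1) indep5] rank B(3) by simp
    \<comment> \<open>The listed matrices must be distinct for the set to have five
      elements.\<close>
    moreover have "M \<notin> {N, L, A, mat 1}" "N \<notin> {L, A, mat 1}" "L \<notin> {A, mat 1}" "A \<noteq> mat 1"
      using nspan N_notin L_notin A_notin cmat.span_base singletonI by metis+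
    ultimately show False
      by simp
  qed
  moreover have "cmat.span {N, L, A, mat 1} \<subseteq> {X. X $ x $ x = X $ u $ u}" for x
    by (intro cmat.span_minimal)
      (auto simp: cmat.subspace_def cscale_def mat_def A_nth L_nth N_nth irrefl)
  moreover have "cmat.span {N, L, A, mat 1} \<subseteq> {X. X $ x $ y = X $ u $ w}" if "adj x y" for x y
  proof -
    have "x \<noteq> y" "u \<noteq> w"
      using that uw irrefl by auto
    then show ?thesis
      using that uw
      by (intro cmat.span_minimal)
        (auto simp: cmat.subspace_def cscale_def mat_def A_nth L_nth N_nth)
  qed
  ultimately show thesis
    using that[of "M $ u $ u" "M $ u $ w"] by blast
qed

theorem theorem2p3:
  fixes adj :: "'n::finite \<Rightarrow> 'n \<Rightarrow> bool"
  assumes "neumaier_graph adj"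
    and "coherent_rank adj \<le> 4"
  shows "strongly_regular adj"
proof (rule ccontr)
  assume not_srg: "\<not> strongly_regular adj"
  have er: "edge_regular adj" and incomplete: "\<not> complete_graph adj"
    using assms(1) by (auto simp: neumaier_graph_def)
  obtain k where simple: "simple_graph adj" and deg: "card {y. adj x y} = k" for x
    using er by (auto simp: edge_regular_def edge_regular_with_def)
  obtain C e where C: "clique adj C" and "e > 0"
    and nexus: "x \<notin> C \<Longrightarrow> card {y \<in> C. adj x y} = e" for x
    using assms(1) by (auto simp: neumaier_graph_def)
  have irrefl: "\<not> adj x x" and sym: "adj x y \<longleftrightarrow> adj y x" for x y
    using simple by (auto simp: simple_graph_def)
  \<comment> \<open>Any candidate for \<mu> fails at some non-edge \<open>p\<close>,
    \<open>q\<close>; the count found there, taken as the next candidate, fails at \<open>r\<close>,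
    \<open>s\<close>.\<close>
  obtain p q r s where pq: "p \<noteq> q" "\<not> adj p q" and rs: "r \<noteq> s" "\<not> adj r s"
    and ne: "card {z. adj p z \<and> adj q z} \<noteq> card {z. adj r z \<and> adj s z}"
    using not_srg er unfolding strongly_regular_def by metis
  have C_nonempty: "C \<noteq> {}"
    using nexus \<open>e > 0\<close> by fastforce
  \<comment> \<open>The vertex of a one-element clique would be adjacent to all others, so
    regularity would make the graph complete.\<close>
  have "card C \<noteq> 1"
  proof
    assume "card C = 1"
    then obtain x where x: "C = {x}"
      by (auto simp: card_1_singleton_iff)
    have dom: "adj y x" if "y \<noteq> x" for y
    proof (rule ccontr)
      assume "\<not> adj y x"
      then have none: "{z \<in> C. adj y z} = {}"
        by (auto simp: x)
      have "y \<notin> C"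
        using that by (simp add: x)
      then show False
        using nexus[of y] \<open>e > 0\<close> unfolding none by simp
    qed
    then have "{y. adj x y} = UNIV - {x}"
      using irrefl sym by auto
    then have "k = card (UNIV - {x})"
      using deg by metis
    have "adj y z" if "y \<noteq> z" for y z
    proof -
      have sub: "{w. adj y w} \<subseteq> UNIV - {y}"
        using irrefl by auto
      have "card (UNIV - {y}) = card {w. adj y w}"
        using deg[of y] \<open>k = _\<close> by simp
      then have "{w. adj y w} = UNIV - {y}"
        using sub by (intro card_subset_eq) auto
      then show ?thesis
        using that by auto
    qed
    then show False
      using incomplete by (simp add: complete_graph_def)
  qed
  then have c2: "card C \<ge> 2"
    using C_nonempty card_gt_0_iff[of C] by simp

  define c :: complex where "c = of_nat (card C)"
  define \<theta> where "\<theta> = c - 1 - of_nat e"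
  define A where "A = adjacency_matrix adj"
  define P where "P = A - mat \<theta>"
  \<comment> \<open>The weights k and c - 1 make tr(Q M) = k tr M + (c - 1) tr(A M) a multiple of d
    + (c - 1) a, the sum of a row of M over the clique. As Q P u = e k c 1 and J u = c 1,
    subtracting e k J makes \<open>B\<close> kill \<open>u\<close>.\<close>
  define Q where "Q = mat (of_nat k) + mat (c - 1) ** A"
  define B where "B = Q ** P - mat (of_nat (e * k)) ** all_ones"
  define M where "M = P ** B"
  define one :: "complex^'n" where "one = (\<chi> i. 1)"
  define u :: "complex^'n" where "u = (\<chi> i. if i \<in> C then 1 else 0)"
  let ?W = "coherent_closure adj"

  have A_nth: "A $ x $ y = (if adj x y then 1 else 0)" for x y
    by (simp add: A_def adjacency_matrix_def)
  have A_one: "A *v one = of_nat k *s one"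
    by (simp add: vec_eq_iff matrix_vector_mult_def one_def A_nth sum.If_cases deg)
  have card_C: "card {y \<in> C. adj x y} = (if x \<in> C then card C - 1 else e)" for x
  proof (cases "x \<in> C")
    case True
    then have "{y \<in> C. adj x y} = C - {x}"
      using C irrefl by (auto simp: clique_def)
    then show ?thesis
      using True by simp
  qed (simp add: nexus)
  have A_u: "A *v u = \<theta> *s u + of_nat e *s one"
  proof -
    have "(A *v u) $ x = of_nat (card {y \<in> C. adj x y})" for x
    proof -
      have "(A *v u) $ x = (\<Sum>y\<in>UNIV. if y \<in> C \<and> adj x y then 1 else 0)"
        by (auto simp: matrix_vector_mult_def u_def A_nth intro!: sum.cong)
      then show ?thesis
        by (simp add: sum.If_cases)
    qed
    then show ?thesis
      using c2 by (simp add: vec_eq_iff card_C u_def one_def \<theta>_def c_def of_nat_diff)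
  qed
  have J_one: "all_ones *v one = of_nat CARD('n) *s one"
    by (simp add: vec_eq_iff matrix_vector_mult_def one_def all_ones_def)
  have J_u: "all_ones *v u = c *s one"
    by (simp add: vec_eq_iff matrix_vector_mult_def one_def all_ones_def u_def c_def sum.If_cases)
  \<comment> \<open>The entries of A u are summed in two ways: by the column sums k of A, and by
    \<open>A_u\<close>. This identity makes \<open>B\<close> kill \<open>one\<close>.\<close>
  have count: "of_nat k * c = \<theta> * c + of_nat e * of_nat CARD('n)"
  proof -
    have "of_nat k * c = (\<Sum>y\<in>UNIV. \<Sum>x\<in>UNIV. A $ x $ y * u $ y)"
    proof -
      have "(\<Sum>x\<in>UNIV. A $ x $ y * u $ y) = of_nat k * u $ y" for y
        using deg[of y] by (simp add: A_nth sum.If_cases sym[of _ y] flip: sum_distrib_right)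
      then show ?thesis
        by (simp add: u_def c_def sum.If_cases flip: sum_distrib_left)
    qed
    also have "\<dots> = (\<Sum>x\<in>UNIV. (A *v u) $ x)"
      unfolding matrix_vector_mult_def by (subst sum.swap) simp
    also have "\<dots> = \<theta> * c + of_nat e * of_nat CARD('n)"
      unfolding A_u by (simp add: one_def u_def c_def sum.distrib sum.If_cases flip: sum_distrib_left)
    finally show ?thesis .
  qed
  have P_u: "P *v u = of_nat e *s one"
    by (simp add: P_def matrix_vector_mult_diff_rdistrib mat_mult_vector A_u)
  have P_one: "P *v one = (of_nat k - \<theta>) *s one"
    by (simp add: P_def matrix_vector_mult_diff_rdistrib mat_mult_vector A_one vec_eq_iff algebra_simps)
  have Q_one: "Q *v one = (of_nat k * c) *s one"
    by (simp add: Q_def matrix_vector_mult_add_rdistrib mat_mult_vector A_one vec_eq_iff algebra_simps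
        flip: matrix_vector_mul_assoc)
  have B_u: "B *v u = 0"
    by (simp add: B_def matrix_vector_mult_diff_rdistrib mat_mult_vector P_u Q_one J_u
        vector_scalar_commute vec_eq_iff algebra_simps flip: matrix_vector_mul_assoc)
  have B_one: "B *v one = 0"
  proof -
    have "(of_nat k - \<theta>) * (of_nat k * c) = of_nat (e * k) * of_nat CARD('n)"
      using count by (simp add: algebra_simps)
    then have "Q *v (P *v one) = (of_nat (e * k) * of_nat CARD('n)) *s one"
      by (simp only: P_one vector_scalar_commute Q_one vector_smult_assoc)
    then show ?thesis
      by (simp add: B_def matrix_vector_mult_diff_rdistrib mat_mult_vector J_one
        flip: matrix_vector_mul_assoc)
  qed

  have M_in: "M \<in> ?W"
  proof -
    note W = coherent_algebra_coherent_closure[of adj]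
    note closed = coherent_algebra_add[OF W] coherent_algebra_diff[OF W]
      coherent_algebra_mult[OF W] coherent_algebra_mat[OF W] coherent_algebra_all_ones[OF W]
    have "A \<in> ?W"
      by (simp add: A_def adjacency_matrix_in_coherent_closure)
    then show ?thesis
      unfolding M_def B_def P_def Q_def by (intro closed)
  qed
  obtain d a where d: "M $ x $ x = d" and a: "adj x y \<Longrightarrow> M $ x $ y = a" for x y
    using coherent_closure_constant_on_edges[OF simple assms(2) pq rs ne M_in] by metis

  have "c * (d + (c - 1) * a) = 0"
  proof -
    \<comment> \<open>The other c - 1 clique vertices are neighbours of \<open>x\<close>, so each
      contributes the edge value.\<close>
    have row: "(\<Sum>y\<in>C. M $ x $ y) = d + (c - 1) * a" if "x \<in> C" for x
    proof -
      have "(\<Sum>y\<in>C. M $ x $ y) = M $ x $ x + (\<Sum>y\<in>C - {x}. M $ x $ y)"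
        using that by (simp add: sum.remove)
      also have "(\<Sum>y\<in>C - {x}. M $ x $ y) = (\<Sum>y\<in>C - {x}. a)"
        using C that by (intro sum.cong refl a) (auto simp: clique_def)
      finally show ?thesis
        using c2 that by (simp add: d c_def of_nat_diff)
    qed
    have "(\<Sum>y\<in>C. M $ x $ y) = (M *v u) $ x" for x
      by (simp add: matrix_vector_mult_def u_def if_distrib[where f = "\<lambda>z. _ * z"] sum.If_cases
          cong: if_cong)
    moreover have "M *v u = 0"
      by (simp add: M_def B_u flip: matrix_vector_mul_assoc)
    ultimately show ?thesis
      using row C_nonempty by force
  qed
  then have da: "d + (c - 1) * a = 0"
    using c2 by (auto simp: c_def)

  have "trace (B ** B) = of_nat CARD('n) * of_nat k * (d + (c - 1) * a)"
  proof -
    \<comment> \<open>Only the left factor is expanded, since P B = M. The term with J will drop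
      out: tr(J B) is the sum of the entries of B 1 = 0.\<close>
    have "B ** B = Q ** M - mat (of_nat (e * k)) ** (all_ones ** B)"
      by (subst (1) B_def) (simp add: M_def matrix_mul_assoc matrix_sub_rdistrib)
    also have "Q ** M = mat (of_nat k) ** M + mat (c - 1) ** (A ** M)"
      by (simp add: Q_def matrix_add_rdistrib matrix_mul_assoc)
    finally have "trace (B ** B) = of_nat k * trace M + (c - 1) * trace (A ** M)
        - of_nat (e * k) * trace (all_ones ** B)"
      by (simp add: trace_def mat_mult_component sum.distrib sum_subtractf sum_distrib_left)
    also have "trace M = of_nat CARD('n) * d"
      by (simp add: trace_def d)
    also have "trace (A ** M) = of_nat CARD('n) * of_nat k * a"
    proof -
      \<comment> \<open>A is supported on edges, so only the edge value of M enters, once for each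
        of the v k ordered adjacent pairs.\<close>
      have "A $ x $ y * M $ y $ x = A $ x $ y * a" for x y
        using a[of y x] sym[of x y] by (simp add: A_nth)
      then have "trace (A ** M) = (\<Sum>x\<in>UNIV. \<Sum>y\<in>UNIV. A $ x $ y * a)"
        by (simp only: trace_mult)
      then show ?thesis
        by (simp add: A_nth sum.If_cases deg flip: sum_distrib_right)
    qed
    also have "trace (all_ones ** B) = (\<Sum>x\<in>UNIV. (B *v one) $ x)"
      by (subst trace_mul_sym) (simp add: trace_mult all_ones_def matrix_vector_mult_def one_def)
    finally show ?thesis
      by (simp add: B_one algebra_simps)
  qed
  then have trace0: "trace (B ** B) = 0"
    by (simp add: da)

  \<comment> \<open>The explicit entries show that \<open>B\<close> is real and symmetric, which
    makes the trace of its square a sum of squares; on non-edges they reduce to (c - 1) times the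
    number of common neighbours, minus e k.\<close>
  have B_nth: "B $ x $ y = (c - 1) * of_nat (card {z. adj x z \<and> adj y z})
      + (of_nat k - \<theta> * (c - 1)) * A $ x $ y - (if x = y then of_nat k * \<theta> else 0)
      - of_nat (e * k)" for x y
  proof -
    have "Q ** P = mat (of_nat k) ** A - mat (of_nat k) ** mat \<theta>
        + mat (c - 1) ** (A ** A) - mat (c - 1) ** (A ** mat \<theta>)"
      by (simp add: Q_def P_def matrix_add_rdistrib matrix_sub_ldistrib matrix_mul_assoc)
    moreover have "(A ** A) $ x $ y = of_nat (card {z. adj x z \<and> adj y z})"
      unfolding A_def by (rule adjacency_square_component[OF simple])
    ultimately show ?thesis
      by (simp add: B_def mat_mult_component mult_mat_component mat_component all_ones_def)
        (simp add: algebra_simps)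
  qed
  have "B $ x $ y * B $ y $ x = complex_of_real ((cmod (B $ x $ y))\<^sup>2)" for x y
  proof -
    have "B $ x $ y \<in> \<real>"
      by (simp add: B_nth A_nth \<theta>_def c_def)
    moreover have "B $ y $ x = B $ x $ y"
      by (simp add: B_nth A_nth sym[of x y] conj_commute eq_commute[of x y])
    ultimately show ?thesis
      unfolding complex_norm_square by (simp add: Reals_cnj_iff)
  qed
  then have "complex_of_real (\<Sum>x\<in>UNIV. \<Sum>y\<in>UNIV. (cmod (B $ x $ y))\<^sup>2) = 0"
    using trace0 by (simp add: trace_mult)
  then have "(\<Sum>x\<in>UNIV. \<Sum>y\<in>UNIV. (cmod (B $ x $ y))\<^sup>2) = 0"
    by (simp only: of_real_eq_0_iff)
  then have B_zero: "B $ x $ y = 0" for x y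
    by (simp add: sum_nonneg_eq_0_iff sum_nonneg)
  have "(c - 1) * of_nat (card {z. adj x z \<and> adj y z}) = of_nat (e * k)"
    if "x \<noteq> y" "\<not> adj x y" for x y
    using B_zero[of x y] that by (simp add: B_nth A_nth)
  from this[OF pq] this[OF rs]
  have "(c - 1) * of_nat (card {z. adj p z \<and> adj q z})
      = (c - 1) * of_nat (card {z. adj r z \<and> adj s z})"
    by simp
  moreover have "c - 1 \<noteq> 0"
    using c2 by (auto simp: c_def)
  ultimately show False
    using ne by simp
qed

end
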